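(* Let $H(\Delta)$ be the entropy-distortion function of the sawbridge. If $\Delta\ge 1/6$, then $H(\Delta)=0$. For every $0<\Delta<1/6$, $$H(\Delta) = -\left\lfloor \tfrac{1}{p}\right\rfloor p\log p - q\log q,$$ where $q = 1 - \lfloor 1/p\rfloor\, p$ and $p$ is the unique number in $(0,1)$ such that $$\left\lfloor \tfrac{1}{p}\right\rfloor p^2 + q^2 = 6\Delta.$$
   Context: Let $U$ be uniformly distributed on $[0,1]$. The sawbridge is the random process $X(t) = t - \mathbf{1}(t\ge U)$, $t\in[0,1]$, viewed as a random element of $L^2[0,1]$. An encoder is a (measurable) map $f:L^2[0,1]\to\mathbb{N}$. Its entropy and distortion are $$H(f) = -\sum_{i\in\mathbb{N}} P(f(X)=i)\log P(f(X)=i),\qquad D(f) = E\Big[\int_0^1 \big(X(t)-E[X(t)\mid f(X)]\big)^2\,dt\Big].$$ All logarithms are base 2 (with $0\log 0=0$). The entropy-distortion function is $H(\Delta) = \inf\{H(f): f \text{ an encoder with } D(f)\le\Delta\}$. *)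

theory Defs
  imports "HOL-Analysis.Analysis"
begin

definition sawbridge :: "real \<Rightarrow> real \<Rightarrow> real" where
  "sawbridge u t = t - (if t \<ge> u then 1 else 0)"

definition U_dist :: "real measure" where
  "U_dist = uniform_measure lborel {0..1}"

text \<open>Representatives of elements of L^2[0,1] (functions real => real, only
  their values on [0,1] matter).\<close>
definition L2_01 :: "(real \<Rightarrow> real) set" where
  "L2_01 = {x. (\<lambda>t. indicator {0..1} t * x t) \<in> borel_measurable lborel
             \<and> set_integrable lborel {0..1::real} (\<lambda>t. (x t)\<^sup>2)}"

definition L2_dist2 :: "(real \<Rightarrow> real) \<Rightarrow> (real \<Rightarrow> real) \<Rightarrow> real" where
  "L2_dist2 x y = (LINT t:{0..1}|lborel. (x t - y t)\<^sup>2)"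

text \<open>Borel sigma-algebra of L^2[0,1]: generated by the open balls of the L^2
  (pseudo)metric (L^2[0,1] is separable, so this is the Borel sigma-algebra).\<close>
definition L2_borel :: "(real \<Rightarrow> real) measure" where
  "L2_borel = sigma L2_01
     {{x \<in> L2_01. L2_dist2 x y < r} | y r. y \<in> L2_01 \<and> r > 0}"

definition encoder :: "((real \<Rightarrow> real) \<Rightarrow> nat) \<Rightarrow> bool" where
  "encoder f \<longleftrightarrow> f \<in> measurable L2_borel (count_space UNIV)"

definition cell_prob :: "((real \<Rightarrow> real) \<Rightarrow> nat) \<Rightarrow> nat \<Rightarrow> real" where
  "cell_prob f i = measure U_dist {u \<in> space U_dist. f (sawbridge u) = i}"

definition entropy :: "((real \<Rightarrow> real) \<Rightarrow> nat) \<Rightarrow> ennreal" where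
  "entropy f = (\<Sum>i. ennreal (if cell_prob f i = 0 then 0
                                else - cell_prob f i * log 2 (cell_prob f i)))"

definition cond_mean :: "((real \<Rightarrow> real) \<Rightarrow> nat) \<Rightarrow> nat \<Rightarrow> real \<Rightarrow> real" where
  "cond_mean f i t =
     (\<integral>u. indicator {u. f (sawbridge u) = i} u * sawbridge u t \<partial>U_dist) / cell_prob f i"

definition distortion :: "((real \<Rightarrow> real) \<Rightarrow> nat) \<Rightarrow> real" where
  "distortion f =
     (\<integral>u. (LINT t:{0..1}|lborel. (sawbridge u t - cond_mean f (f (sawbridge u)) t)\<^sup>2) \<partial>U_dist)"

definition entropy_distortion :: "real \<Rightarrow> ennreal" where
  "entropy_distortion \<Delta> = (INF f \<in> {f. encoder f \<and> distortion f \<le> \<Delta>}. entropy f)"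

end

theory Submission
  imports Defs "HOL-Probability.Probability_Measure"
begin

text \<open>
  An encoder partitions the jump time into cells \<open>A\<^sub>i\<close> of measure \<open>p\<^sub>i\<close>. With
  \<open>G(t) = |A\<^sub>i \<inter> [0, t]|\<close>, the cell contributes \<open>\<integral> G (p\<^sub>i - G) / p\<^sub>i dt\<close> to the distortion. Since
  \<open>G\<close> is 1-Lipschitz, comparison with a parabola centred at the median of \<open>A\<^sub>i\<close> bounds this below
  by \<open>p\<^sub>i\<^sup>2 / 6\<close>, with equality for intervals. Hence one has to minimize the entropy of
  \<open>(p\<^sub>i)\<close> subject to \<open>\<Sum> p\<^sub>i\<^sup>2 \<le> 6 \<Delta>\<close>.

  Let \<open>(p, \<dots>, p, q)\<close> be the candidate with \<open>k\<close> entries \<open>p\<close>, and let \<open>a\<close> be the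
  \<open>(k + 1)\<close>-st largest \<open>p\<^sub>i\<close>; then \<open>0 < a < p\<close> unless \<open>q = 0\<close>. Some combination \<open>\<Psi>\<close> of
  \<open>-x ln x\<close>, \<open>x\<close> and a nonnegative multiple of \<open>x\<^sup>2\<close> is critical exactly at \<open>a\<close> and \<open>p\<close>,
  with shape increasing, decreasing, increasing and \<open>\<Psi>(0) = 0\<close>. So the \<open>k\<close> largest entries have
  \<open>\<Psi>(p\<^sub>i) \<ge> \<Psi>(p)\<close>, the next one \<open>\<Psi>(a) \<ge> \<Psi>(q)\<close>, and the rest \<open>\<Psi>(p\<^sub>i) \<ge> 0\<close>;
  summing gives the entropy bound. For \<open>q = 0\<close> the bound is Jensen's inequality.
\<close>

section \<open>Entropy under a bound on the sum of squares\<close>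

definition eta :: "real \<Rightarrow> real" where
  "eta x = (if x = 0 then 0 else - x * log 2 x)"

lemma eta_nonneg: "0 \<le> x \<Longrightarrow> x \<le> 1 \<Longrightarrow> 0 \<le> eta x"
  unfolding eta_def by (auto simp: mult_nonneg_nonpos)

section \<open>Largest terms of a null sequence\<close>

text \<open>A positive value outside \<open>I\<close> exceeds all but finitely many terms, so only a
  finite maximum has to be taken. If there is none, all terms outside \<open>I\<close> vanish and
  any fresh index serves.\<close>

lemma ex_max_outside:
  fixes x :: "nat \<Rightarrow> real"
  assumes nonneg: "\<And>i. 0 \<le> x i" and lim: "x \<longlonglongrightarrow> 0" and fin: "finite I"
  shows "\<exists>j. j \<notin> I \<and> (\<forall>i. i \<notin> I \<longrightarrow> x i \<le> x j)"
proof (cases "\<exists>l. l \<notin> I \<and> 0 < x l")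
  case True
  then obtain l where l: "l \<notin> I" "0 < x l" by blast
  obtain N where N: "\<And>n. n \<ge> N \<Longrightarrow> x n < x l"
    using order_tendstoD(2)[OF lim l(2)] unfolding eventually_sequentially by blast
  let ?S = "insert l ({..<N} - I)"
  have "Max (x ` ?S) \<in> x ` ?S" by (rule Max_in) auto
  then obtain j where j: "j \<in> ?S" "Max (x ` ?S) = x j" by (elim imageE) simp
  have max: "x i \<le> x j" if "i \<in> ?S" for i
    unfolding j(2)[symmetric] using that by (intro Max_ge) auto
  have "x i \<le> x j" if "i \<notin> I" for i
    using that max[of i] max[of l] N[of i] by (cases "i < N") force+
  then show ?thesis using j(1) l(1) by auto
next
  case False
  then have "x i = 0" if "i \<notin> I" for i using that nonneg[of i] by force
  then show ?thesis using ex_new_if_finite[OF infinite_UNIV_nat fin] by (metis order_refl)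
qed

lemma ex_largest_values:
  fixes x :: "nat \<Rightarrow> real"
  assumes nonneg: "\<And>i. 0 \<le> x i" and lim: "x \<longlonglongrightarrow> 0"
  shows "\<exists>I. finite I \<and> card I = k \<and> (\<forall>i\<in>I. \<forall>j. j \<notin> I \<longrightarrow> x j \<le> x i)"
proof (induction k)
  case 0
  show ?case by (intro exI[of _ "{}"]) auto
next
  case (Suc k)
  then obtain I where I: "finite I" "card I = k" "\<forall>i\<in>I. \<forall>j. j \<notin> I \<longrightarrow> x j \<le> x i" by blast
  obtain j where j: "j \<notin> I" "\<forall>i. i \<notin> I \<longrightarrow> x i \<le> x j"
    using ex_max_outside[OF nonneg lim I(1)] by blast
  show ?case using I j by (intro exI[of _ "insert j I"]) auto
qed

text \<open>Cauchy-Schwarz, obtained by expanding the nonnegative sum of squared deviations from the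
  mean \<open>m\<close>.\<close>

lemma card_sum_squares_ge:
  fixes x :: "'a \<Rightarrow> real"
  assumes "finite I" "card I = k" "0 < k"
  shows "(\<Sum>i\<in>I. x i)\<^sup>2 / k \<le> (\<Sum>i\<in>I. (x i)\<^sup>2)"
proof -
  define m where "m = (\<Sum>i\<in>I. x i) / k"
  have "0 \<le> (\<Sum>i\<in>I. (x i - m)\<^sup>2)" by (intro sum_nonneg) auto
  also have "\<dots> = (\<Sum>i\<in>I. (x i)\<^sup>2) - 2 * m * (\<Sum>i\<in>I. x i) + k * m\<^sup>2"
    using assms
    by (simp add: power2_diff sum.distrib sum_subtractf sum_distrib_left sum_distrib_right algebra_simps)
  also have "\<dots> = (\<Sum>i\<in>I. (x i)\<^sup>2) - (\<Sum>i\<in>I. x i)\<^sup>2 / k"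
    using assms by (simp add: m_def field_simps power2_eq_square)
  finally show ?thesis by simp
qed

text \<open>An antiderivative of the difference between the chord of \<open>ln\<close> through \<open>a\<close>, \<open>b\<close> and \<open>ln\<close>:
  it increases on \<open>[0, a]\<close>, decreases on \<open>[a, b]\<close> and increases again beyond \<open>b\<close>.\<close>

definition barrier :: "real \<Rightarrow> real \<Rightarrow> real \<Rightarrow> real" where
  "barrier a b x =
     (let \<beta> = (ln b - ln a) / (b - a) in
      x - x * ln x + (ln a - \<beta> * a) * x + \<beta> * x\<^sup>2 / 2)"

lemma barrier_deriv:
  assumes "0 < x"
  shows "(barrier a b has_real_derivative (ln a + (ln b - ln a) / (b - a) * (x - a) - ln x)) (at x)"
proof -
  define \<beta> where "\<beta> = (ln b - ln a) / (b - a)"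
  have *: "barrier a b = (\<lambda>x. x - x * ln x + (ln a - \<beta> * a) * x + \<beta> * x\<^sup>2 / 2)"
    by (simp add: barrier_def \<beta>_def Let_def fun_eq_iff)
  show ?thesis unfolding * \<beta>_def[symmetric] using assms
    by (auto intro!: derivative_eq_intros simp: field_simps)
qed


text \<open>Concavity of \<open>ln\<close>: both slopes are compared with the tangent slope
  \<open>1 / y\<close>. The cross-multiplied form stays valid when two of the points
  coincide.\<close>

lemma ln_slopes_antimono:
  fixes x y z :: real
  assumes "0 < x" "x \<le> y" "y \<le> z"
  shows "(y - x) * (ln z - ln y) \<le> (z - y) * (ln y - ln x)"
proof -
  have y: "0 < y" "0 < z" using assms by auto
  have "ln (x / y) \<le> x / y - 1" "ln (z / y) \<le> z / y - 1"
    using assms y by (intro ln_le_minus_one divide_pos_pos; simp)+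
  then have *: "(y - x) / y \<le> ln y - ln x" "ln z - ln y \<le> (z - y) / y"
    using assms y by (simp_all add: ln_div diff_divide_distrib)
  have "(y - x) * (ln z - ln y) \<le> (y - x) * ((z - y) / y)"
    using * assms by (intro mult_left_mono) auto
  also have "\<dots> = (z - y) * ((y - x) / y)" by simp
  also have "\<dots> \<le> (z - y) * (ln y - ln x)"
    using * assms by (intro mult_left_mono) auto
  finally show ?thesis .
qed

context
  fixes a b :: real
  assumes ab: "0 < a" "a < b"
begin

lemma chord_ge_ln:
  assumes "0 < x" "x \<le> a \<or> b \<le> x"
  shows "ln x \<le> ln a + (ln b - ln a) / (b - a) * (x - a)"
proof -
  have "(b - a) * (ln x - ln a) \<le> (ln b - ln a) * (x - a)"
    using ln_slopes_antimono[of x a b] ln_slopes_antimono[of a b x] assms ab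
    by (auto simp: algebra_simps)
  then show ?thesis using ab by (simp add: field_simps)
qed

lemma chord_le_ln:
  assumes "a \<le> x" "x \<le> b"
  shows "ln a + (ln b - ln a) / (b - a) * (x - a) \<le> ln x"
proof -
  have "(b - a) * (ln x - ln a) \<ge> (ln b - ln a) * (x - a)"
    using ln_slopes_antimono[of a x b] assms ab by (auto simp: algebra_simps)
  then show ?thesis using ab by (simp add: field_simps)
qed

lemma barrier_deriv_nonneg:
  assumes "0 < x" "x \<le> a \<or> b \<le> x"
  shows "\<exists>y. (barrier a b has_real_derivative y) (at x) \<and> 0 \<le> y"
  using barrier_deriv[OF assms(1), of a b] chord_ge_ln[OF assms] by auto

lemma barrier_deriv_nonpos:
  assumes "a \<le> x" "x \<le> b"
  shows "\<exists>y. (barrier a b has_real_derivative y) (at x) \<and> y \<le> 0"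
  using barrier_deriv[of x a b] chord_le_ln[OF assms] assms ab by auto

text \<open>\<open>barrier_deriv\<close> does not reach 0, so instead of monotonicity a factor
  \<open>x\<close> is split off. By the chord bound the other factor is at least
  \<open>1 - \<beta> * x / 2\<close>, which is positive because
  \<open>\<beta> * x \<le> \<beta> * a \<le> 1\<close>.\<close>

lemma barrier_nonneg:
  assumes "0 \<le> x" "x \<le> a"
  shows "0 \<le> barrier a b x"
proof (cases "x = 0")
  case False
  then have x: "0 < x" using assms by simp
  define \<beta> where "\<beta> = (ln b - ln a) / (b - a)"
  have "ln (b / a) \<le> b / a - 1" using ab by (intro ln_le_minus_one divide_pos_pos) auto
  then have "ln b - ln a \<le> (b - a) / a" using ab by (simp add: ln_div diff_divide_distrib)
  then have \<beta>: "\<beta> * a \<le> 1" using ab by (simp add: \<beta>_def field_simps)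
  have "0 \<le> \<beta>" using ab by (simp add: \<beta>_def)
  then have "\<beta> * x \<le> \<beta> * a" using assms by (intro mult_left_mono)
  then have "0 \<le> 1 - ln x + (ln a - \<beta> * a) + \<beta> * x / 2"
    using chord_ge_ln[of x] x assms \<beta> \<open>0 \<le> \<beta>\<close> mult_nonneg_nonneg[of \<beta> x]
    unfolding \<beta>_def[symmetric] by (simp add: algebra_simps)
  then have "0 \<le> x * (1 - ln x + (ln a - \<beta> * a) + \<beta> * x / 2)" using x by simp
  also have "\<dots> = barrier a b x"
    by (simp add: barrier_def Let_def \<beta>_def[symmetric] algebra_simps power2_eq_square)
  finally show ?thesis .
qed (simp add: barrier_def Let_def)

lemma barrier_le_left:
  assumes "0 \<le> x" "x \<le> b"
  shows "barrier a b x \<le> barrier a b a"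
proof -
  consider "x = 0" | "0 < x" "x \<le> a" | "a \<le> x" using assms by linarith
  then show ?thesis
  proof cases
    case 1
    then show ?thesis using barrier_nonneg[of a] ab by (simp add: barrier_def Let_def)
  next
    case 2
    show ?thesis
      by (rule DERIV_nonneg_imp_nondecreasing[OF 2(2)])
        (use 2 barrier_deriv_nonneg in force)
  next
    case 3
    show ?thesis
      by (rule DERIV_nonpos_imp_nonincreasing[OF 3])
        (use assms ab barrier_deriv_nonpos in force)
  qed
qed

lemma barrier_ge_right:
  assumes "a \<le> x"
  shows "barrier a b b \<le> barrier a b x"
proof (cases "x \<le> b")
  case True
  show ?thesis
    by (rule DERIV_nonpos_imp_nonincreasing[OF True])
      (use assms ab barrier_deriv_nonpos in force)
next
  case False
  then have "b \<le> x" by simp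
  then show ?thesis
    by (rule DERIV_nonneg_imp_nondecreasing)
      (use ab barrier_deriv_nonneg in force)
qed

text \<open>Lagrangian form: summed over a distribution, the linear coefficient multiplies the total
  mass and the quadratic one the sum of squares. The factor \<open>ln 2\<close> converts the base of
  the logarithm.\<close>

lemma barrier_eq_eta:
  "barrier a b x = ln 2 * eta x
     + (1 + ln a - (ln b - ln a) / (b - a) * a) * x + (ln b - ln a) / (b - a) / 2 * x\<^sup>2"
  by (simp add: barrier_def Let_def eta_def log_def algebra_simps)

end

lemma entropy_min:
  fixes x :: "nat \<Rightarrow> real" and k :: nat and p q :: real
  assumes nonneg: "\<And>i. 0 \<le> x i" and sums1: "x sums 1"
    and sq: "summable (\<lambda>i. (x i)\<^sup>2)" "(\<Sum>i. (x i)\<^sup>2) \<le> k * p\<^sup>2 + q\<^sup>2"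
    and ent: "summable (\<lambda>i. eta (x i))"
    and k: "0 < k" and q: "q = 1 - k * p" "0 \<le> q" "q < p"
  shows "k * eta p + eta q \<le> (\<Sum>i. eta (x i))"
proof -
  have p: "0 < p" using q by simp
  have kp: "k * p \<le> 1" using q by simp
  have summ: "summable x" "suminf x = 1" using sums1 by (auto simp: sums_iff)
  have l2: "ln 2 > (0::real)" by simp
  show ?thesis
  proof (cases "q = 0")
    case True
    then have pk: "k * p = 1" using q by simp
    \<comment> \<open>This is \<open>ln t \<le> t - 1\<close> at \<open>t = y / p\<close>. Equality
      holds at \<open>y = 0\<close> and \<open>y = p\<close>, the only values that the candidate
      takes.\<close>
    have t: "ln 2 * eta y \<ge> y * (1 - ln p) - y\<^sup>2 / p" if "0 \<le> y" for y
    proof (cases "y = 0")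
      case False
      then have y: "0 < y" using that by simp
      then have "ln (y / p) \<le> y / p - 1" using p by (intro ln_le_minus_one divide_pos_pos)
      then have "y * (ln y - ln p) \<le> y * (y / p - 1)"
        using y p by (intro mult_left_mono) (auto simp: ln_div)
      then show ?thesis using y by (simp add: eta_def log_def algebra_simps power2_eq_square)
    qed (simp add: eta_def)
    have s1: "summable (\<lambda>i. x i * (1 - ln p) - (x i)\<^sup>2 / p)"
      using summ sq by (intro summable_diff summable_mult2 summable_divide)
    have "(\<Sum>i. x i * (1 - ln p) - (x i)\<^sup>2 / p) \<le> (\<Sum>i. ln 2 * eta (x i))"
      using ent by (intro suminf_le t nonneg s1 summable_mult)
    moreover have "(\<Sum>i. x i * (1 - ln p) - (x i)\<^sup>2 / p) = (1 - ln p) - (\<Sum>i. (x i)\<^sup>2) / p"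
      using summ sq
      by (simp add: suminf_diff[symmetric] suminf_mult2[symmetric] suminf_divide[symmetric]
          summable_mult2 summable_divide)
    moreover have "(\<Sum>i. ln 2 * eta (x i)) = ln 2 * (\<Sum>i. eta (x i))"
      using ent by (rule suminf_mult)
    moreover have "(\<Sum>i. (x i)\<^sup>2) / p \<le> 1"
    proof -
      have "(\<Sum>i. (x i)\<^sup>2) \<le> (k * p) * p" using sq True by (simp add: power2_eq_square)
      then show ?thesis using pk p by simp
    qed
    moreover have "ln 2 * (k * eta p + eta q) = - (k * p) * ln p"
      using p True by (simp add: eta_def log_def)
    ultimately have "ln 2 * (k * eta p + eta q) \<le> ln 2 * (\<Sum>i. eta (x i))" using pk by simp
    then show ?thesis using l2 by simp
  next
    case False
    then have q0: "0 < q" using q by simp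
    obtain I where I: "finite I" "card I = k" "\<forall>i\<in>I. \<forall>j. j \<notin> I \<longrightarrow> x j \<le> x i"
      using ex_largest_values[OF nonneg summable_LIMSEQ_zero[OF summ(1)]] by blast
    obtain j where j: "j \<notin> I" "\<forall>i. i \<notin> I \<longrightarrow> x i \<le> x j"
      using ex_max_outside[OF nonneg summable_LIMSEQ_zero[OF summ(1)] I(1)] by blast
    define a where "a = x j"
    \<comment> \<open>With \<open>a = 0\<close> at most \<open>k\<close> entries are nonzero, so
      Cauchy-Schwarz makes the sum of squares at least \<open>1 / k\<close>; but
      \<open>k * p\<^sup>2 + q\<^sup>2\<close> is below \<open>1 / k\<close> when
      \<open>0 < q < p\<close>.\<close>
    have a0: "0 < a"
    proof (rule ccontr)
      assume "\<not> 0 < a"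
      then have z: "x i = 0" if "i \<notin> I" for i
        using that j nonneg[of i] nonneg[of j] unfolding a_def by force
      have "(\<Sum>i\<in>I. x i) = 1" "(\<Sum>i\<in>I. (x i)\<^sup>2) = (\<Sum>i. (x i)\<^sup>2)"
        using suminf_finite[of I x] suminf_finite[of I "\<lambda>i. (x i)\<^sup>2"] I z summ by auto
      then have "1 / k \<le> k * p\<^sup>2 + q\<^sup>2"
        using card_sum_squares_ge[OF I(1,2) k, of x] sq by simp
      then have "1 \<le> k * (k * p\<^sup>2 + q\<^sup>2)" using k by (simp add: field_simps)
      also have "\<dots> = (k * p) * (k * p) + k * q * q" by (simp add: power2_eq_square algebra_simps)
      also have "\<dots> < (k * p) * (k * p) + k * p * q"
        using q0 q k by simp
      also have "\<dots> = k * p * (k * p + q)" by (simp add: algebra_simps)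
      also have "\<dots> \<le> 1" using q by simp
      finally show False by simp
    qed
    \<comment> \<open>Otherwise \<open>k + 1\<close> entries are at least \<open>p\<close>, with
      total at least \<open>(k + 1) * p > k * p + q = 1\<close>.\<close>
    have ap: "a < p"
    proof (rule ccontr)
      assume "\<not> a < p"
      then have "p \<le> x i" if "i \<in> insert j I" for i
        using that I(3) j(1) unfolding a_def by force
      then have "real (card (insert j I)) * p \<le> (\<Sum>i\<in>insert j I. x i)"
        by (intro sum_bounded_below)
      also have "\<dots> \<le> 1"
        using sum_le_suminf[OF summ(1), of "insert j I"] summ I nonneg by simp
      finally show False using I j q by (simp add: algebra_simps)
    qed
    define \<beta> where "\<beta> = (ln p - ln a) / (p - a)"
    define \<gamma> where "\<gamma> = 1 + ln a - \<beta> * a"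
    \<comment> \<open>The sign of this multiplier is what makes an upper bound on the sum of squares
      usable.\<close>
    have \<beta>: "0 \<le> \<beta>" using a0 ap by (simp add: \<beta>_def)
    let ?B = "barrier a p"
    have B: "?B y = ln 2 * eta y + \<gamma> * y + \<beta> / 2 * y\<^sup>2" for y
      using barrier_eq_eta[OF a0 ap, of y] unfolding \<gamma>_def \<beta>_def .
    have sB: "summable (\<lambda>i. ?B (x i))"
      unfolding B using ent summ sq by (intro summable_add summable_mult)
    have "k * ?B p + ?B q \<le> (\<Sum>i\<in>I. ?B (x i)) + ?B (x j)"
    proof (rule add_mono)
      show "k * ?B p \<le> (\<Sum>i\<in>I. ?B (x i))"
        unfolding I(2)[symmetric]
        using I(3) j(1) by (intro sum_bounded_below barrier_ge_right[OF a0 ap]) (auto simp: a_def)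
      show "?B q \<le> ?B (x j)"
        using barrier_le_left[OF a0 ap, of q] q by (simp add: a_def)
    qed
    also have "\<dots> = (\<Sum>i\<in>insert j I. ?B (x i))" using I j by simp
    also have "\<dots> \<le> (\<Sum>i. ?B (x i))"
      using I j nonneg
      by (intro sum_le_suminf[OF sB] barrier_nonneg[OF a0 ap]) (auto simp: a_def)
    also have "\<dots> = ln 2 * (\<Sum>i. eta (x i)) + \<gamma> + \<beta> / 2 * (\<Sum>i. (x i)\<^sup>2)"
    proof -
      have "(\<lambda>i. ?B (x i)) sums (ln 2 * (\<Sum>i. eta (x i)) + \<gamma> * 1 + \<beta> / 2 * (\<Sum>i. (x i)\<^sup>2))"
        unfolding B using ent sums1 sq by (intro sums_add sums_mult summable_sums)
      then show ?thesis by (simp add: sums_iff)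
    qed
    also have "\<dots> \<le> ln 2 * (\<Sum>i. eta (x i)) + \<gamma> + \<beta> / 2 * (k * p\<^sup>2 + q\<^sup>2)"
      using sq \<beta> by (intro add_mono mult_left_mono) auto
    finally have "k * ?B p + ?B q \<le> \<dots>" .
    moreover have "k * ?B p + ?B q
        = ln 2 * (k * eta p + eta q) + \<gamma> * (k * p + q) + \<beta> / 2 * (k * p\<^sup>2 + q\<^sup>2)"
      unfolding B by (simp add: algebra_simps)
    moreover have "k * p + q = 1" using q by simp
    ultimately have "ln 2 * (k * eta p + eta q) \<le> ln 2 * (\<Sum>i. eta (x i))" by simp
    then show ?thesis using l2 by simp
  qed
qed

section \<open>Solving the constraint for p\<close>

text \<open>Collision probability of the distribution that takes as many masses \<open>p\<close> as
  fit into 1 and one atom for the remainder.\<close>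

definition coincidence :: "real \<Rightarrow> real" where
  "coincidence p = of_int \<lfloor>1/p\<rfloor> * p\<^sup>2 + (1 - of_int \<lfloor>1/p\<rfloor> * p)\<^sup>2"

lemma floor_recip_eq_iff:
  fixes p :: real and k :: nat
  assumes "0 < p" "0 < k"
  shows "\<lfloor>1/p\<rfloor> = int k \<longleftrightarrow> 1 < (k + 1) * p \<and> k * p \<le> 1"
  using assms by (auto simp: floor_eq_iff field_simps)

lemma floor_recip_nat:
  fixes p :: real
  assumes "0 < p" "p \<le> 1"
  obtains k :: nat where "0 < k" "\<lfloor>1/p\<rfloor> = int k" "1 < (k + 1) * p" "k * p \<le> 1"
proof -
  have "1 \<le> \<lfloor>1/p\<rfloor>" using assms by (simp add: le_floor_iff)
  then have "\<lfloor>1/p\<rfloor> = int (nat \<lfloor>1/p\<rfloor>)" "0 < nat \<lfloor>1/p\<rfloor>" by auto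
  then show ?thesis using that floor_recip_eq_iff[OF assms(1)] by blast
qed

text \<open>With \<open>r = (k + 1) * p - 1\<close> the constraint \<open>coincidence p = s\<close> reads \<open>k * r\<^sup>2 + 1 = (k + 1) * s\<close>.\<close>

lemma square_sum_eq:
  fixes p :: real and k :: nat
  shows "(k + 1) * (k * p\<^sup>2 + (1 - k * p)\<^sup>2) = k * ((k + 1) * p - 1)\<^sup>2 + 1"
  by (simp add: algebra_simps power2_eq_square)

text \<open>From \<open>0 < r \<le> 1 / k\<close> it follows that
  \<open>(k + 1) * coincidence p = k * r\<^sup>2 + 1\<close> lies in \<open>(1, 1 + 1 / k]\<close>.
  So \<open>coincidence\<close> maps each interval \<open>(1 / (k + 1), 1 / k]\<close> into itself,
  and \<open>k\<close> can be read off from its value.\<close>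

lemma floor_recip_coincidence:
  assumes "0 < p" "p \<le> 1"
  shows "0 < coincidence p" "\<lfloor>1 / coincidence p\<rfloor> = \<lfloor>1/p\<rfloor>"
proof -
  obtain k :: nat where k: "0 < k" "\<lfloor>1/p\<rfloor> = int k" "1 < (k + 1) * p" "k * p \<le> 1"
    using floor_recip_nat[OF assms] .
  define r where "r = (k + 1) * p - 1"
  have s: "(k + 1) * coincidence p = k * r\<^sup>2 + 1"
    using square_sum_eq[of k p] by (simp add: coincidence_def k(2) r_def)
  have r: "0 < r" using k by (simp add: r_def)
  have "k * r = (k + 1) * (k * p) - k" by (simp add: r_def algebra_simps)
  also have "\<dots> \<le> real (k + 1) * 1 - real k" using k by (intro diff_right_mono mult_left_mono) auto
  finally have kr: "k * r \<le> 1" by simp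
  have "1 < (k + 1) * coincidence p" using s r k(1) by simp
  moreover have "(k + 1) * (k * coincidence p) \<le> (k + 1) * 1"
  proof -
    have "(k * r) * (k * r) \<le> 1 * 1" using kr r by (intro mult_mono) auto
    moreover have "(k + 1) * (k * coincidence p) = k * (k * r\<^sup>2 + 1)"
      using s by (metis mult.left_commute)
    ultimately show ?thesis by (simp add: algebra_simps power2_eq_square)
  qed
  then have "k * coincidence p \<le> 1" by (simp add: mult_le_cancel_left_pos del: of_nat_Suc)
  moreover show "0 < coincidence p"
    using calculation(1) by (smt (verit) mult_nonneg_nonpos of_nat_0_le_iff)
  ultimately show "\<lfloor>1 / coincidence p\<rfloor> = \<lfloor>1/p\<rfloor>"
    using floor_recip_eq_iff[of "coincidence p" k] k by auto
qed

text \<open>Equal values force the same \<open>k\<close>; then \<open>r\<^sup>2\<close> is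
  determined, and \<open>r\<close> is its nonnegative root.\<close>

lemma coincidence_inj:
  assumes "0 < p" "p \<le> 1" "0 < p'" "p' \<le> 1" "coincidence p = coincidence p'"
  shows "p = p'"
proof -
  obtain k :: nat where k: "0 < k" "\<lfloor>1/p\<rfloor> = int k" "1 < (k + 1) * p" "k * p \<le> 1"
    using floor_recip_nat[OF assms(1,2)] .
  have k': "\<lfloor>1/p'\<rfloor> = int k"
    using floor_recip_coincidence[OF assms(1,2)] floor_recip_coincidence[OF assms(3,4)] assms(5) k
    by simp
  then have k'': "1 < (k + 1) * p'" using floor_recip_eq_iff assms k by blast
  have "k * ((k + 1) * p - 1)\<^sup>2 = k * ((k + 1) * p' - 1)\<^sup>2"
    using assms(5) square_sum_eq[of k p] square_sum_eq[of k p']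
    unfolding coincidence_def k(2) k' by simp
  then have "((k + 1) * p - 1)\<^sup>2 = ((k + 1) * p' - 1)\<^sup>2" using k(1) by simp
  moreover have "0 \<le> (k + 1) * p - 1" "0 \<le> (k + 1) * p' - 1" using k(3) k'' by linarith+
  ultimately have "(k + 1) * p - 1 = (k + 1) * p' - 1" by (rule power2_eq_imp_eq)
  then have "real (k + 1) * p = real (k + 1) * p'" by linarith
  then show ?thesis by (simp only: mult_cancel_left of_nat_eq_0_iff) simp
qed

text \<open>Take \<open>k\<close> from \<open>s\<close> itself and solve
  \<open>k * r\<^sup>2 + 1 = (k + 1) * s\<close> for the positive root \<open>r\<close>. Here
  \<open>k * s \<le> 1\<close> yields \<open>k * r \<le> 1\<close>, which gives the resulting
  \<open>p\<close> the right floor.\<close>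

lemma coincidence_surj:
  assumes "0 < s" "s < 1"
  shows "\<exists>p. 0 < p \<and> p < 1 \<and> coincidence p = s"
proof -
  obtain k :: nat where k: "0 < k" "\<lfloor>1/s\<rfloor> = int k" "1 < (k + 1) * s" "k * s \<le> 1"
    using floor_recip_nat[of s] assms by auto
  define r where "r = sqrt (((k + 1) * s - 1) / k)"
  define p where "p = (1 + r) / (k + 1)"
  have r: "0 < r" using k by (simp add: r_def)
  have r2: "k * r\<^sup>2 = (k + 1) * s - 1" using k by (simp add: r_def)
  have "(k * r)\<^sup>2 = k * (k * r\<^sup>2)" by (simp add: power2_eq_square)
  also have "\<dots> = (k + 1) * (k * s) - k" unfolding r2 by (simp add: algebra_simps)
  also have "\<dots> \<le> real (k + 1) * 1 - real k" using k by (intro diff_right_mono mult_left_mono) auto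
  finally have "(k * r)\<^sup>2 \<le> 1\<^sup>2" by simp
  then have kr: "k * r \<le> 1" by (rule power2_le_imp_le) simp
  have p1: "(k + 1) * p = 1 + r" by (simp add: p_def)
  have "(k + 1) * (k * p) = k * (1 + r)" unfolding p1[symmetric] by (rule mult.left_commute)
  then have "(k + 1) * (k * p) \<le> (k + 1) * 1" using kr by (simp add: distrib_left)
  then have kp: "k * p \<le> 1" by (simp add: mult_le_cancel_left_pos del: of_nat_Suc)
  have p0: "0 < p" using r by (simp add: p_def)
  have "\<lfloor>1/p\<rfloor> = int k" using floor_recip_eq_iff[OF p0 k(1)] p1 r kp by simp
  then have "(k + 1) * coincidence p = (k + 1) * s"
    using square_sum_eq[of k p] r2 p1 by (simp add: coincidence_def)
  then have c: "coincidence p = s" by simp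
  have "1 * p \<le> k * p" using k(1) p0 by (intro mult_right_mono) auto
  then have "p \<le> 1" using kp by simp
  moreover have "p \<noteq> 1" using c assms by (auto simp: coincidence_def)
  ultimately show ?thesis using p0 c by auto
qed

section \<open>The uniform jump time and the mass of a cell\<close>

lemma U_dist_eq_density: "U_dist = density lborel (indicator {0..1})"
  unfolding U_dist_def uniform_measure_def by (rule density_cong) (auto split: split_indicator)

interpretation U: prob_space U_dist
  unfolding U_dist_def by (rule prob_space_uniform_measure) auto

interpretation UU: pair_prob_space U_dist U_dist ..

lemma sets_U_dist [simp, measurable_cong]: "sets U_dist = sets borel"
  by (simp add: U_dist_def)

lemma space_U_dist [simp]: "space U_dist = UNIV"
  by (simp add: U_dist_def)

lemma measurable_U_dist: "measurable U_dist N = measurable borel N"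
  by (rule measurable_cong_sets) auto

lemma AE_U_dist: "AE t in U_dist. 0 \<le> t \<and> t \<le> 1"
  unfolding U_dist_def by (rule AE_uniform_measureI) auto

lemma measure_U_dist: "A \<in> sets borel \<Longrightarrow> measure U_dist A = measure lborel ({0..1} \<inter> A)"
  by (simp add: U_dist_def)

lemma integral_U_dist:
  fixes f :: "real \<Rightarrow> real"
  assumes "f \<in> borel_measurable borel"
  shows "(\<integral>t. f t \<partial>U_dist) = (LINT t:{0..1}|lborel. f t)"
proof -
  have "U_dist = density lborel (\<lambda>t. ennreal (indicator {0..1} t))"
    by (simp add: U_dist_eq_density ennreal_indicator)
  then show ?thesis
    using assms integral_real_density[of "indicator {0..1}" lborel f]
    by (simp add: set_lebesgue_integral_def)
qed

lemma sawbridge_measurable_pair [measurable]: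
  "(\<lambda>z. sawbridge (fst z) (snd z)) \<in> borel_measurable (borel \<Otimes>\<^sub>M borel)"
  unfolding sawbridge_def by measurable

lemma sawbridge_measurable_time [measurable]: "sawbridge u \<in> borel_measurable borel"
  unfolding sawbridge_def by measurable

lemma sawbridge_L2: "sawbridge u \<in> L2_01"
proof -
  have "set_integrable lborel {0..1} (\<lambda>t. (sawbridge u t)\<^sup>2)"
    unfolding set_integrable_def
  proof (rule integrableI_bounded_set_indicator[where B=1])
    show "AE t in lborel. t \<in> {0..1} \<longrightarrow> norm ((sawbridge u t)\<^sup>2) \<le> 1"
      by (auto simp: sawbridge_def abs_square_le_1)
  qed auto
  then show ?thesis by (auto simp: L2_01_def)
qed

lemma L2_dist2_measurable:
  assumes "y \<in> L2_01"
  shows "(\<lambda>x. L2_dist2 x y) \<in> borel_measurable L2_borel"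
proof (rule borel_measurableI_less)
  fix r :: real
  have sp: "space L2_borel = L2_01" unfolding L2_borel_def by (rule space_measure_of) auto
  show "{x \<in> space L2_borel. L2_dist2 x y < r} \<in> sets L2_borel"
  proof (cases "r > 0")
    case True
    then show ?thesis unfolding sp unfolding L2_borel_def
      using assms by (intro in_measure_of) auto
  next
    case False
    \<comment> \<open>For \<open>r \<le> 0\<close> the sublevel set is not one of the generating
      balls, but it is empty.\<close>
    have "L2_dist2 x y \<ge> 0" for x
      unfolding L2_dist2_def set_lebesgue_integral_def by (rule integral_nonneg_AE) auto
    then have "{x \<in> space L2_borel. L2_dist2 x y < r} = {}"
      using False by (auto simp: not_less intro: order_trans)
    then show ?thesis by (simp only: sets.empty_sets)
  qed
qed

text \<open>It suffices to test the generating balls. The distance to a fixed \<open>y\<close> is an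
  integral over \<open>t\<close> of a function jointly measurable in \<open>u\<close> and
  \<open>t\<close>, hence measurable in \<open>u\<close>.\<close>

lemma sawbridge_measurable [measurable]: "sawbridge \<in> measurable borel L2_borel"
  unfolding L2_borel_def
proof (rule measurable_measure_of)
  fix B assume "B \<in> {{x \<in> L2_01. L2_dist2 x y < r} |y r. y \<in> L2_01 \<and> 0 < r}"
  then obtain y r where y: "y \<in> L2_01" and B: "B = {x \<in> L2_01. L2_dist2 x y < r}" by auto
  have [measurable]: "(\<lambda>t. indicator {0..1} t * y t) \<in> borel_measurable lborel"
    using y by (simp add: L2_01_def)
  \<comment> \<open>Membership in \<open>L2_01\<close> gives measurability on \<open>{0..1}\<close>
    only, so \<open>y\<close> enters cut off there.\<close>
  have eq: "L2_dist2 (sawbridge u) y =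
      (\<integral>t. indicator {0..1} t * (sawbridge u t - indicator {0..1} t * y t)\<^sup>2 \<partial>lborel)" for u
    unfolding L2_dist2_def set_lebesgue_integral_def
    by (rule Bochner_Integration.integral_cong) (auto split: split_indicator)
  have "(\<lambda>u. L2_dist2 (sawbridge u) y) \<in> borel_measurable borel"
    unfolding eq by measurable
  then have "{u. L2_dist2 (sawbridge u) y < r} \<in> sets borel" by measurable
  moreover have "sawbridge -` B \<inter> space borel = {u. L2_dist2 (sawbridge u) y < r}"
    using sawbridge_L2 by (auto simp: B)
  ultimately show "sawbridge -` B \<inter> space borel \<in> sets borel" by simp
qed (use sawbridge_L2 in auto)

section \<open>The mass function of a set of jump times\<close>

definition mass_upto :: "real set \<Rightarrow> real \<Rightarrow> real" where
  "mass_upto A t = measure U_dist (A \<inter> {..t})"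

lemma measure_U_dist_interval_le:
  assumes "s \<le> t"
  shows "measure U_dist {s<..t} \<le> t - s"
proof -
  have "measure U_dist {s<..t} = measure lborel ({0..1} \<inter> {s<..t})" by (rule measure_U_dist) simp
  also have "\<dots> \<le> measure lborel {s<..t}"
    using assms by (intro measure_mono_fmeasurable) (auto intro!: fmeasurableI)
  finally show ?thesis using assms by simp
qed

context
  fixes A :: "real set"
  assumes A [measurable]: "A \<in> sets borel"
begin

lemma mass_upto_bounds: "0 \<le> mass_upto A t" "mass_upto A t \<le> measure U_dist A"
  unfolding mass_upto_def by (auto intro!: U.finite_measure_mono)

text \<open>The increment is the mass of \<open>A\<close> in \<open>{s<..t}\<close>, hence at most
  the length of that interval.\<close>

lemma mass_upto_diff:
  assumes "s \<le> t"
  shows "0 \<le> mass_upto A t - mass_upto A s" "mass_upto A t - mass_upto A s \<le> t - s"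
proof -
  have "A \<inter> {..t} = A \<inter> {..s} \<union> A \<inter> {s<..t}" using assms by auto
  then have "mass_upto A t = mass_upto A s + measure U_dist (A \<inter> {s<..t})"
    unfolding mass_upto_def by (simp, subst U.finite_measure_Union) auto
  moreover have "measure U_dist (A \<inter> {s<..t}) \<le> measure U_dist {s<..t}"
    by (intro U.finite_measure_mono) auto
  ultimately show "0 \<le> mass_upto A t - mass_upto A s" "mass_upto A t - mass_upto A s \<le> t - s"
    using measure_U_dist_interval_le[OF assms] by auto
qed

lemma mass_upto_lipschitz: "\<bar>mass_upto A t - mass_upto A s\<bar> \<le> \<bar>t - s\<bar>"
  using mass_upto_diff[of s t] mass_upto_diff[of t s] by linarith

lemma continuous_mass_upto: "continuous_on UNIV (mass_upto A)"
proof (rule continuous_onI)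
  fix x e :: real assume "0 < e"
  then show "\<exists>d>0. \<forall>x'\<in>UNIV. dist x' x < d \<longrightarrow> dist (mass_upto A x') (mass_upto A x) \<le> e"
    using mass_upto_lipschitz[of _ x]
    by (intro exI[of _ e]) (auto simp: dist_real_def intro: order_trans[OF _ less_imp_le])
qed

lemma measurable_mass_upto [measurable]: "mass_upto A \<in> borel_measurable borel"
  using continuous_mass_upto by (rule borel_measurable_continuous_onI)

lemma mass_upto_0: "mass_upto A 0 = 0"
proof -
  have "mass_upto A 0 = measure lborel ({0..1} \<inter> (A \<inter> {..0}))"
    unfolding mass_upto_def by (rule measure_U_dist) auto
  also have "\<dots> \<le> measure lborel {0::real..0}"
    by (intro measure_mono_fmeasurable) (auto intro!: fmeasurableI)
  finally show ?thesis using mass_upto_bounds(1)[of 0] by simp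
qed

lemma mass_upto_1: "mass_upto A 1 = measure U_dist A"
proof -
  have "{0..1} \<inter> (A \<inter> {..1}) = {0..1::real} \<inter> A" by auto
  then show ?thesis unfolding mass_upto_def by (simp add: measure_U_dist)
qed

end

text \<open>The lower bound for a cell and its equality case both reduce to this parabola over the
  interval where it is nonnegative. The hypotheses keep that interval inside
  \<open>{0..1}\<close>.\<close>

lemma integral_bump:
  assumes "0 \<le> h" "0 \<le> c - h" "c + h \<le> 1"
  shows "(\<integral>t. indicator {c - h..c + h} t * (h\<^sup>2 - (t - c)\<^sup>2) \<partial>U_dist) = 4 / 3 * h ^ 3"
proof -
  have "(\<integral>t. indicator {c - h..c + h} t * (h\<^sup>2 - (t - c)\<^sup>2) \<partial>U_dist)
      = (\<integral>t. indicator {0..1} t *\<^sub>R (indicator {c - h..c + h} t * (h\<^sup>2 - (t - c)\<^sup>2)) \<partial>lborel)"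
    by (subst integral_U_dist) (auto simp: set_lebesgue_integral_def)
  also have "\<dots> = (\<integral>t. (h\<^sup>2 - (t - c)\<^sup>2) * indicator {c - h..c + h} t \<partial>lborel)"
    using assms by (intro Bochner_Integration.integral_cong) (auto split: split_indicator)
  also have "\<dots> = (h\<^sup>2 * ((c + h) - c) - ((c + h) - c) ^ 3 / 3)
      - (h\<^sup>2 * ((c - h) - c) - ((c - h) - c) ^ 3 / 3)"
    using assms
    by (intro integral_FTC_Icc_real[where F = "\<lambda>t. h\<^sup>2 * (t - c) - (t - c) ^ 3 / 3"])
      (auto intro!: derivative_eq_intros continuous_intros)
  also have "\<dots> = 4 / 3 * h ^ 3" by (simp add: power2_eq_square power3_eq_cube)
  finally show ?thesis .
qed

text \<open>At the median \<open>c\<close> of \<open>A\<close> the mass function equals half the total mass, and being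
  1-Lipschitz it deviates from that by at most \<open>\<bar>t - c\<bar>\<close>.\<close>

lemma integral_mass_ge:
  assumes A [measurable]: "A \<in> sets borel" and P: "P = measure U_dist A"
  shows "P ^ 3 / 6 \<le> (\<integral>t. mass_upto A t * (P - mass_upto A t) \<partial>U_dist)"
proof -
  let ?G = "mass_upto A"
  have P01: "0 \<le> P" "P \<le> 1" using P by auto
  have "\<exists>c\<ge>0. c \<le> 1 \<and> ?G c = P / 2"
    using P01 mass_upto_0[OF A] mass_upto_1[OF A] continuous_mass_upto[OF A]
    by (intro IVT') (auto simp: P intro: continuous_on_subset)
  then obtain c where c: "0 \<le> c" "c \<le> 1" "?G c = P / 2" by blast
  \<comment> \<open>Mass \<open>P / 2\<close> lies on each side of \<open>c\<close> and accumulates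
    at most at unit rate, so the interval of radius \<open>P / 2\<close> about \<open>c\<close> fits
    into \<open>{0..1}\<close>.\<close>
  have c': "P / 2 \<le> c" "P / 2 \<le> 1 - c"
    using mass_upto_diff[OF A, of 0 c] mass_upto_diff[OF A, of c 1] c
      mass_upto_0[OF A] mass_upto_1[OF A] P by auto
  let ?I = "{c - P / 2..c + P / 2}"
  have bnd: "0 \<le> ?G t" "?G t \<le> P" for t using mass_upto_bounds[OF A, of t] P by auto
  have int: "integrable U_dist (\<lambda>t. ?G t * (P - ?G t))"
  proof (rule U.integrable_const_bound[where B="1"])
    show "AE t in U_dist. norm (?G t * (P - ?G t)) \<le> 1"
    proof (rule AE_I2)
      fix t
      have "?G t * (P - ?G t) \<le> 1 * 1"
        using bnd[of t] P01 by (intro mult_mono) linarith+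
      then show "norm (?G t * (P - ?G t)) \<le> 1" using bnd[of t] by simp
    qed
  qed (simp add: measurable_U_dist)
  have "P ^ 3 / 6 = 4 / 3 * (P / 2) ^ 3" by (simp add: power_divide)
  also have "\<dots> = (\<integral>t. indicator ?I t * ((P / 2)\<^sup>2 - (t - c)\<^sup>2) \<partial>U_dist)"
    using integral_bump[of "P / 2" c] P01 c' by simp
  also have "\<dots> \<le> (\<integral>t. ?G t * (P - ?G t) \<partial>U_dist)"
  proof (rule integral_mono_AE')
    show "AE t in U_dist. indicator ?I t * ((P / 2)\<^sup>2 - (t - c)\<^sup>2) \<le> ?G t * (P - ?G t)"
    proof (rule AE_I2)
      fix t
      have "(?G t - P / 2)\<^sup>2 \<le> (t - c)\<^sup>2"
        using mass_upto_lipschitz[OF A, of t c] c(3) by (simp add: abs_le_square_iff)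
      moreover have "?G t * (P - ?G t) = (P / 2)\<^sup>2 - (?G t - P / 2)\<^sup>2"
        by (simp add: power2_eq_square algebra_simps)
      ultimately show "indicator ?I t * ((P / 2)\<^sup>2 - (t - c)\<^sup>2) \<le> ?G t * (P - ?G t)"
        using mult_nonneg_nonneg[of "?G t" "P - ?G t"] bnd[of t] by (auto split: split_indicator)
    qed
    show "AE t in U_dist. 0 \<le> ?G t * (P - ?G t)" using bnd by simp
  qed (rule int)
  finally show ?thesis .
qed

text \<open>The equality case: the mass function is a ramp of slope 1, so the integrand is
  \<open>(t - a) * (b - t)\<close> on the interval and 0 outside, which is exactly the bump around
  the midpoint.\<close>

lemma integral_mass_interval:
  assumes A [measurable]: "A \<in> sets borel" and ab: "0 \<le> a" "a \<le> b" "b \<le> 1"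
    and eq: "A \<inter> {0..<1} = {a..<b}"
  shows "measure U_dist A = b - a"
    and "(\<integral>t. mass_upto A t * ((b - a) - mass_upto A t) \<partial>U_dist) = (b - a) ^ 3 / 6"
proof -
  \<comment> \<open>The endpoint 1 is a null set, so it is enough to know the cell on
    \<open>{0..<1}\<close>, which half-open intervals can tile.\<close>
  have m: "measure U_dist B = measure lborel ({0..<1} \<inter> B)" if [measurable]: "B \<in> sets borel" for B
  proof -
    have "measure U_dist B = measure lborel ({0..1} \<inter> B)" by (rule measure_U_dist) fact
    also have "\<dots> = measure lborel ({0..<1} \<inter> B)"
    proof (rule measure_eq_AE)
      show "AE x in lborel. x \<in> {0..1} \<inter> B \<longleftrightarrow> x \<in> {0..<1} \<inter> B"
        using AE_lborel_singleton[of "1::real"] by eventually_elim auto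
    qed auto
    finally show ?thesis .
  qed
  show "measure U_dist A = b - a" using m[OF A] eq ab by (simp add: Int_commute)
  have G: "mass_upto A t = (if t < a then 0 else if t \<le> b then t - a else b - a)" for t
  proof -
    have "mass_upto A t = measure lborel ({0..<1} \<inter> (A \<inter> {..t}))"
      unfolding mass_upto_def by (rule m) simp
    also have "{0..<1} \<inter> (A \<inter> {..t}) = {a..<b} \<inter> {..t}" using eq by blast
    also have "\<dots> = (if t < a then {} else if t < b then {a..t} else {a..<b})" by auto
    also have "measure lborel \<dots> = (if t < a then 0 else if t \<le> b then t - a else b - a)"
      using ab by auto
    finally show ?thesis .
  qed
  let ?c = "(a + b) / 2" and ?h = "(b - a) / 2"
  have "mass_upto A t * ((b - a) - mass_upto A t)
      = indicator {?c - ?h..?c + ?h} t * (?h\<^sup>2 - (t - ?c)\<^sup>2)" for t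
    unfolding G using ab by (auto split: split_indicator simp: field_simps power2_eq_square)
  then have "(\<integral>t. mass_upto A t * ((b - a) - mass_upto A t) \<partial>U_dist) = 4 / 3 * ?h ^ 3"
    using ab by (simp only:) (rule integral_bump, auto simp: field_simps)
  then show "(\<integral>t. mass_upto A t * ((b - a) - mass_upto A t) \<partial>U_dist) = (b - a) ^ 3 / 6"
    by (simp add: power_divide)
qed

section \<open>Distortion of an encoder\<close>

definition cell :: "((real \<Rightarrow> real) \<Rightarrow> nat) \<Rightarrow> nat \<Rightarrow> real set" where
  "cell f i = {u. f (sawbridge u) = i}"

lemma cell_prob_eq: "cell_prob f i = measure U_dist (cell f i)"
  by (simp add: cell_prob_def cell_def)

lemma cell_prob_bounds: "0 \<le> cell_prob f i" "cell_prob f i \<le> 1"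
  by (simp_all add: cell_prob_eq)

text \<open>Not divided by the probability of the cell, so that the contributions add up to the
  distortion.\<close>

definition cell_distortion :: "((real \<Rightarrow> real) \<Rightarrow> nat) \<Rightarrow> nat \<Rightarrow> real" where
  "cell_distortion f i =
     (\<integral>u. indicator (cell f i) u *
        (\<integral>t. (sawbridge u t - cond_mean f (f (sawbridge u)) t)\<^sup>2 \<partial>U_dist) \<partial>U_dist)"

lemma integrable_U_pair:
  fixes h :: "real \<Rightarrow> real \<Rightarrow> real"
  assumes [measurable]: "case_prod h \<in> borel_measurable (borel \<Otimes>\<^sub>M borel)"
    and bnd: "\<And>u t. 0 \<le> t \<Longrightarrow> t \<le> 1 \<Longrightarrow> \<bar>h u t\<bar> \<le> 1"
  shows "integrable (U_dist \<Otimes>\<^sub>M U_dist) (case_prod h)"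
proof (rule UU.P.integrable_const_bound[where B=1])
  show meas: "case_prod h \<in> borel_measurable (U_dist \<Otimes>\<^sub>M U_dist)" by measurable
  show "AE z in U_dist \<Otimes>\<^sub>M U_dist. norm (case_prod h z) \<le> 1"
  proof (rule UU.AE_pair_measure)
    show "{z \<in> space (U_dist \<Otimes>\<^sub>M U_dist). norm (case_prod h z) \<le> 1} \<in> sets (U_dist \<Otimes>\<^sub>M U_dist)"
      using meas by measurable
    show "AE u in U_dist. AE t in U_dist. norm (case_prod h (u, t)) \<le> 1"
    proof (rule AE_I2)
      fix u
      show "AE t in U_dist. norm (case_prod h (u, t)) \<le> 1"
        using AE_U_dist by eventually_elim (use bnd in auto)
    qed
  qed
qed

lemma integrable_indicator_U [simp]:
  "B \<in> sets borel \<Longrightarrow> integrable U_dist (indicator B :: real \<Rightarrow> real)"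
  by (simp add: U.emeasure_eq_measure)

context
  fixes f :: "(real \<Rightarrow> real) \<Rightarrow> nat"
  assumes enc: "encoder f"
begin

lemma encoder_sawbridge_measurable [measurable]:
  "(\<lambda>u. f (sawbridge u)) \<in> measurable borel (count_space UNIV)"
  using measurable_compose[OF sawbridge_measurable, of f] enc by (simp add: encoder_def)

lemma cell_measurable [measurable]: "cell f i \<in> sets borel"
  unfolding cell_def by measurable

lemma cell_prob_sums: "cell_prob f sums 1"
proof -
  have "(\<lambda>i. measure U_dist (cell f i)) sums measure U_dist (\<Union>i. cell f i)"
    using cell_measurable
    by (intro U.finite_measure_UNION) (auto simp: disjoint_family_on_def cell_def)
  moreover have "(\<Union>i. cell f i) = space U_dist" by (auto simp: cell_def)
  ultimately show ?thesis
    using U.prob_space by (simp add: cell_prob_eq[abs_def] del: space_U_dist)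
qed

text \<open>Integrating the jump indicator at time \<open>t\<close> over the cell gives the mass of
  the cell up to \<open>t\<close>. For a null cell the division by zero returns 0.\<close>

lemma cond_mean_eq:
  "cond_mean f i t = (if cell_prob f i = 0 then 0
     else t - mass_upto (cell f i) t / cell_prob f i)"
proof -
  let ?A = "cell f i"
  have "(\<integral>u. indicator ?A u * sawbridge u t \<partial>U_dist)
      = (\<integral>u. t * indicator ?A u - indicator (?A \<inter> {..t}) u \<partial>U_dist)"
    by (rule Bochner_Integration.integral_cong) (auto split: split_indicator simp: sawbridge_def)
  also have "\<dots> = t * cell_prob f i - mass_upto ?A t"
    by (subst Bochner_Integration.integral_diff)
      (simp_all add: cell_prob_eq mass_upto_def cell_measurable)
  finally show ?thesis
    unfolding cond_mean_def cell_def[symmetric] by (simp add: field_simps)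
qed

lemma cond_mean_measurable [measurable]: "cond_mean f i \<in> borel_measurable borel"
  unfolding cond_mean_eq[abs_def] using measurable_mass_upto[OF cell_measurable] by measurable

lemma cond_mean_sawbridge_measurable [measurable]:
  "(\<lambda>z. cond_mean f (f (sawbridge (fst z))) (snd z)) \<in> borel_measurable (borel \<Otimes>\<^sub>M borel)"
  by (rule measurable_compose_countable[where f="\<lambda>i z. cond_mean f i (snd z)"
        and g="\<lambda>z. f (sawbridge (fst z))"]) measurable

lemma deviation_bound:
  assumes "0 \<le> t" "t \<le> 1"
  shows "\<bar>sawbridge u t - cond_mean f i t\<bar> \<le> 1"
proof (cases "cell_prob f i = 0")
  case True
  then show ?thesis using assms by (auto simp: cond_mean_eq sawbridge_def)
next
  case False
  then have P: "0 < cell_prob f i" using cell_prob_bounds[of f i] by simp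
  define r where "r = mass_upto (cell f i) t / cell_prob f i"
  have "0 \<le> r" "r \<le> 1"
    using P mass_upto_bounds[OF cell_measurable, of i t] by (auto simp: r_def cell_prob_eq)
  moreover have "sawbridge u t - cond_mean f i t = r - (if t \<ge> u then 1 else 0)"
    using False by (simp add: cond_mean_eq sawbridge_def r_def)
  ultimately show ?thesis by auto
qed

lemma deviation_sq_bound:
  assumes "0 \<le> t" "t \<le> 1"
  shows "(sawbridge u t - cond_mean f i t)\<^sup>2 \<le> 1"
  using deviation_bound[OF assms, of u i] by (simp add: abs_square_le_1)

lemma integrable_deviation:
  "integrable (U_dist \<Otimes>\<^sub>M U_dist)
     (\<lambda>(u, t). (sawbridge u t - cond_mean f (f (sawbridge u)) t)\<^sup>2)"
  by (rule integrable_U_pair) (auto simp: deviation_sq_bound case_prod_beta)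

text \<open>Writing the time integral against \<open>U_dist\<close> as well makes Fubini on the pair
  space applicable.\<close>

lemma distortion_eq:
  "distortion f = (\<integral>u. (\<integral>t. (sawbridge u t - cond_mean f (f (sawbridge u)) t)\<^sup>2 \<partial>U_dist) \<partial>U_dist)"
  unfolding distortion_def
  by (intro Bochner_Integration.integral_cong refl integral_U_dist[symmetric]) measurable

lemma integrable_error:
  "integrable U_dist (\<lambda>u. \<integral>t. (sawbridge u t - cond_mean f (f (sawbridge u)) t)\<^sup>2 \<partial>U_dist)"
  using UU.integrable_fst[OF integrable_deviation] .

lemma integrable_cell_error:
  "integrable U_dist (\<lambda>u. indicator (cell f i) u *
     (\<integral>t. (sawbridge u t - cond_mean f (f (sawbridge u)) t)\<^sup>2 \<partial>U_dist))"
  using integrable_mult_indicator[OF _ integrable_error, of "cell f i"] by simp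

text \<open>Exchange the integrals. For fixed \<open>t\<close> the deviation on the cell is
  \<open>r\<close> minus the indicator of \<open>u \<le> t\<close>, where \<open>r = G / P\<close>
  is the conditional probability of a jump by \<open>t\<close>. The inner integral is therefore
  \<open>P\<close> times a Bernoulli variance, \<open>P * r * (1 - r)\<close>.\<close>

lemma cell_distortion_eq:
  "cell_distortion f i =
     (\<integral>t. mass_upto (cell f i) t * (cell_prob f i - mass_upto (cell f i) t) \<partial>U_dist) / cell_prob f i"
proof -
  let ?A = "cell f i" and ?P = "cell_prob f i" and ?G = "mass_upto (cell f i)"
  have "cell_distortion f i
      = (\<integral>u. (\<integral>t. indicator ?A u * (sawbridge u t - cond_mean f i t)\<^sup>2 \<partial>U_dist) \<partial>U_dist)"
    unfolding cell_distortion_def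
    by (intro Bochner_Integration.integral_cong) (auto split: split_indicator simp: cell_def)
  also have "\<dots> = (\<integral>t. (\<integral>u. indicator ?A u * (sawbridge u t - cond_mean f i t)\<^sup>2 \<partial>U_dist) \<partial>U_dist)"
  proof (rule UU.Fubini_integral[symmetric], rule integrable_U_pair)
    show "(\<lambda>(u, t). indicator ?A u * (sawbridge u t - cond_mean f i t)\<^sup>2)
        \<in> borel_measurable (borel \<Otimes>\<^sub>M borel)"
      unfolding case_prod_beta by measurable
  qed (auto split: split_indicator simp: deviation_sq_bound)
  also have "\<dots> = (\<integral>t. ?G t * (?P - ?G t) / ?P \<partial>U_dist)"
  proof (rule Bochner_Integration.integral_cong[OF refl])
    fix t
    show "(\<integral>u. indicator ?A u * (sawbridge u t - cond_mean f i t)\<^sup>2 \<partial>U_dist) = ?G t * (?P - ?G t) / ?P"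
    proof (cases "?P = 0")
      case True
      then have "emeasure U_dist ?A = 0" by (simp add: cell_prob_eq U.emeasure_eq_measure)
      then have "AE u in U_dist. u \<notin> ?A" by (intro AE_not_in) (auto simp: null_sets_def)
      then have "(\<integral>u. indicator ?A u * (sawbridge u t - cond_mean f i t)\<^sup>2 \<partial>U_dist) = 0"
        by (intro integral_eq_zero_AE) (auto elim: eventually_mono)
      then show ?thesis using True by simp
    next
      case False
      let ?r = "?G t / ?P"
      have "(\<integral>u. indicator ?A u * (sawbridge u t - cond_mean f i t)\<^sup>2 \<partial>U_dist)
          = (\<integral>u. ?r\<^sup>2 * indicator ?A u + (1 - 2 * ?r) * indicator (?A \<inter> {..t}) u \<partial>U_dist)"
        using False
        by (intro Bochner_Integration.integral_cong)
          (auto split: split_indicator simp: sawbridge_def cond_mean_eq power2_eq_square algebra_simps)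
      also have "\<dots> = ?r\<^sup>2 * ?P + (1 - 2 * ?r) * ?G t"
        by (subst Bochner_Integration.integral_add)
          (simp_all add: cell_prob_eq mass_upto_def cell_measurable)
      also have "\<dots> = ?G t * (?P - ?G t) / ?P"
        using False by (simp add: field_simps power2_eq_square)
      finally show ?thesis .
    qed
  qed
  finally show ?thesis by simp
qed

lemma cell_distortion_ge: "(cell_prob f i)\<^sup>2 / 6 \<le> cell_distortion f i"
proof (cases "cell_prob f i = 0")
  case False
  then have P: "0 < cell_prob f i" using cell_prob_bounds[of f i] by simp
  have "(cell_prob f i)\<^sup>2 / 6 = (cell_prob f i) ^ 3 / 6 / cell_prob f i"
    using P by (simp add: power2_eq_square power3_eq_cube)
  also have "\<dots> \<le> cell_distortion f i"
    unfolding cell_distortion_eq using P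
    by (intro divide_right_mono integral_mass_ge[OF cell_measurable cell_prob_eq]) auto
  finally show ?thesis .
qed (simp add: cell_distortion_eq)

text \<open>Finite sums suffice: they bound the distortion from below, and the quantizer used later
  takes finitely many values on jump times in \<open>{0..<1}\<close>.\<close>

lemma sum_cell_distortion:
  assumes "finite I"
  shows "(\<Sum>i\<in>I. cell_distortion f i) = (\<integral>u. indicator (\<Union>i\<in>I. cell f i) u *
     (\<integral>t. (sawbridge u t - cond_mean f (f (sawbridge u)) t)\<^sup>2 \<partial>U_dist) \<partial>U_dist)"
proof -
  have "disjoint_family_on (cell f) I" by (auto simp: disjoint_family_on_def cell_def)
  then have "indicator (\<Union>i\<in>I. cell f i) u = (\<Sum>i\<in>I. indicator (cell f i) u :: real)" for u
    using assms by (intro indicator_UN_disjoint)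
  then show ?thesis
    unfolding cell_distortion_def
    by (simp add: sum_distrib_right Bochner_Integration.integral_sum[OF integrable_cell_error])
qed

lemma distortion_ge_sum:
  assumes "finite I"
  shows "(\<Sum>i\<in>I. (cell_prob f i)\<^sup>2) \<le> 6 * distortion f"
proof -
  have "(\<Sum>i\<in>I. (cell_prob f i)\<^sup>2) / 6 \<le> (\<Sum>i\<in>I. cell_distortion f i)"
    unfolding sum_divide_distrib by (intro sum_mono cell_distortion_ge)
  also have "\<dots> \<le> distortion f"
    unfolding sum_cell_distortion[OF assms] distortion_eq
    by (rule integral_mono_AE'[OF integrable_error]) (auto split: split_indicator)
  finally show ?thesis by simp
qed

lemma distortion_eq_sum:
  assumes "finite I" "\<And>u. 0 \<le> u \<Longrightarrow> u < 1 \<Longrightarrow> f (sawbridge u) \<in> I"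
  shows "distortion f = (\<Sum>i\<in>I. cell_distortion f i)"
  unfolding sum_cell_distortion[OF assms(1)] distortion_eq
proof (rule integral_cong_AE)
  have "AE u in U_dist. u \<noteq> 1"
    unfolding U_dist_def by (rule AE_uniform_measureI) (use AE_lborel_singleton[of "1::real"] in auto)
  then show "AE u in U_dist. (\<integral>t. (sawbridge u t - cond_mean f (f (sawbridge u)) t)\<^sup>2 \<partial>U_dist)
     = indicator (\<Union>i\<in>I. cell f i) u *
     (\<integral>t. (sawbridge u t - cond_mean f (f (sawbridge u)) t)\<^sup>2 \<partial>U_dist)"
    using AE_U_dist by eventually_elim (use assms(2) in \<open>auto simp: cell_def split: split_indicator\<close>)
  show "(\<lambda>u. \<integral>t. (sawbridge u t - cond_mean f (f (sawbridge u)) t)\<^sup>2 \<partial>U_dist) \<in> borel_measurable U_dist"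
    using integrable_error by (rule borel_measurable_integrable)
  then show "(\<lambda>u. indicator (\<Union>i\<in>I. cell f i) u *
     (\<integral>t. (sawbridge u t - cond_mean f (f (sawbridge u)) t)\<^sup>2 \<partial>U_dist)) \<in> borel_measurable U_dist"
    using assms(1) by measurable
qed

lemma cell_interval:
  assumes "0 \<le> a" "a \<le> b" "b \<le> 1" "cell f i \<inter> {0..<1} = {a..<b}"
  shows "cell_prob f i = b - a" "cell_distortion f i = (b - a)\<^sup>2 / 6"
proof -
  show P: "cell_prob f i = b - a"
    unfolding cell_prob_eq by (rule integral_mass_interval(1)[OF cell_measurable assms])
  show "cell_distortion f i = (b - a)\<^sup>2 / 6"
    unfolding cell_distortion_eq P integral_mass_interval(2)[OF cell_measurable assms]
    by (cases "a = b") (simp_all add: power2_eq_square power3_eq_cube divide_simps)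
qed

end

section \<open>Entropy lower bound for arbitrary encoders\<close>

lemma entropy_eq: "entropy f = (\<Sum>i. ennreal (eta (cell_prob f i)))"
  by (simp add: entropy_def eta_def)

text \<open>Infinite entropy satisfies the bound trivially; finite entropy supplies the summability
  that \<open>entropy_min\<close> requires. The squares are summable because the distortion bounds
  their partial sums.\<close>

lemma entropy_ge:
  fixes k :: nat and p q :: real
  assumes f: "encoder f" and D: "6 * distortion f \<le> k * p\<^sup>2 + q\<^sup>2"
    and k: "0 < k" and q: "q = 1 - k * p" "0 \<le> q" "q < p"
  shows "ennreal (k * eta p + eta q) \<le> entropy f"
proof (cases "entropy f = top")
  case False
  have e0: "0 \<le> eta (cell_prob f i)" for i
    using cell_prob_bounds by (rule eta_nonneg)
  have s: "summable (\<lambda>i. eta (cell_prob f i))"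
    using False e0 unfolding entropy_eq by (intro summable_suminf_not_top)
  have le: "(\<Sum>i<n. (cell_prob f i)\<^sup>2) \<le> k * p\<^sup>2 + q\<^sup>2" for n
    using distortion_ge_sum[OF f, of "{..<n}"] D by simp
  have s2: "summable (\<lambda>i. (cell_prob f i)\<^sup>2)"
    using le by (intro summableI_nonneg_bounded) auto
  have "k * eta p + eta q \<le> (\<Sum>i. eta (cell_prob f i))"
    using cell_prob_bounds(1) cell_prob_sums[OF f] s2 suminf_le_const[OF s2 le] s k q
    by (rule entropy_min)
  then have "ennreal (k * eta p + eta q) \<le> ennreal (\<Sum>i. eta (cell_prob f i))" by (rule ennreal_leI)
  also have "\<dots> = entropy f" unfolding entropy_eq using e0 s by (intro suminf_ennreal2[symmetric])
  finally show ?thesis .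
qed simp

text \<open>The jump time is recovered from a path by polarization:
  \<open>\<parallel>x\<parallel>\<^sup>2 - \<parallel>x - 1\<parallel>\<^sup>2 = 2 \<integral>x - 1\<close>, which is \<open>2 u - 2\<close> for the sawbridge jumping at \<open>u\<close>.\<close>

definition jump_time :: "(real \<Rightarrow> real) \<Rightarrow> real" where
  "jump_time x = 1 + (L2_dist2 x (\<lambda>_. 0) - L2_dist2 x (\<lambda>_. 1)) / 2"

lemma const_L2: "(\<lambda>_. c) \<in> L2_01"
  by (auto simp: L2_01_def set_integrable_def)

lemma jump_time_measurable: "jump_time \<in> borel_measurable L2_borel"
  unfolding jump_time_def
  using L2_dist2_measurable[OF const_L2, of 0] L2_dist2_measurable[OF const_L2, of 1] by measurable

lemma jump_time_sawbridge:
  assumes "0 \<le> u" "u \<le> 1"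
  shows "jump_time (sawbridge u) = u"
proof -
  have d: "L2_dist2 (sawbridge u) (\<lambda>_. c) = (\<integral>t. (sawbridge u t - c)\<^sup>2 \<partial>U_dist)" for c
    unfolding L2_dist2_def by (rule integral_U_dist[symmetric]) measurable
  have i: "integrable U_dist (\<lambda>t. (sawbridge u t - c)\<^sup>2)" if "0 \<le> c" "c \<le> 1" for c
  proof (rule U.integrable_const_bound[where B="2\<^sup>2"])
    show "AE t in U_dist. norm ((sawbridge u t - c)\<^sup>2) \<le> 2\<^sup>2"
      using AE_U_dist
    proof eventually_elim
      case (elim t)
      then have "\<bar>sawbridge u t - c\<bar> \<le> 2" using that by (auto simp: sawbridge_def)
      then show ?case using abs_le_square_iff[of "sawbridge u t - c" 2] by simp
    qed
  qed (simp add: measurable_U_dist)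
  have it: "integrable U_dist (\<lambda>t. t)"
    by (rule U.integrable_const_bound[where B=1]) (use AE_U_dist in \<open>auto simp: measurable_U_dist\<close>)
  have t: "(\<integral>t. t \<partial>U_dist) = 1 / 2"
  proof -
    have "(\<integral>t. t \<partial>U_dist) = (\<integral>t. t * indicator {0..1} t \<partial>lborel)"
      by (subst integral_U_dist) (auto simp: set_lebesgue_integral_def mult.commute)
    also have "\<dots> = 1\<^sup>2 / 2 - 0\<^sup>2 / 2"
      by (intro integral_FTC_Icc_real[where F="\<lambda>t. t\<^sup>2 / 2"]) (auto intro!: derivative_eq_intros)
    finally show ?thesis by simp
  qed
  have m: "measure U_dist {u..} = 1 - u"
  proof -
    have "{0..1} \<inter> {u..} = {u..1}" using assms by auto
    then show ?thesis using assms by (simp add: measure_U_dist)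
  qed
  have "L2_dist2 (sawbridge u) (\<lambda>_. 0) - L2_dist2 (sawbridge u) (\<lambda>_. 1)
      = (\<integral>t. (sawbridge u t - 0)\<^sup>2 - (sawbridge u t - 1)\<^sup>2 \<partial>U_dist)"
    unfolding d by (rule Bochner_Integration.integral_diff[symmetric]) (intro i; simp)+
  also have "\<dots> = (\<integral>t. 2 * t - 1 - 2 * indicator {u..} t \<partial>U_dist)"
    by (rule Bochner_Integration.integral_cong)
      (auto split: split_indicator simp: sawbridge_def power2_eq_square algebra_simps)
  also have "\<dots> = 2 * (1 / 2) - 1 - 2 * (1 - u)"
  proof -
    have "(\<integral>t. 2 * t - 1 - 2 * indicator {u..} t \<partial>U_dist)
        = (\<integral>t. 2 * t - 1 \<partial>U_dist) - (\<integral>t. 2 * indicator {u..} t \<partial>U_dist)"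
      using it by (intro Bochner_Integration.integral_diff) auto
    also have "(\<integral>t. 2 * t - 1 \<partial>U_dist) = (\<integral>t. 2 * t \<partial>U_dist) - (\<integral>t. 1 \<partial>U_dist)"
      using it by (intro Bochner_Integration.integral_diff) auto
    finally show ?thesis using U.prob_space by (simp add: t m)
  qed
  finally show ?thesis by (simp add: jump_time_def field_simps)
qed

section \<open>Uniform quantization of the jump time\<close>

text \<open>An encoder sees the path and not \<open>u\<close>, so the division into steps of length
  \<open>p\<close> passes through \<open>jump_time\<close>.\<close>

definition quantizer :: "real \<Rightarrow> (real \<Rightarrow> real) \<Rightarrow> nat" where
  "quantizer p x = nat \<lfloor>jump_time x / p\<rfloor>"

lemma encoder_quantizer: "encoder (quantizer p)"
  unfolding encoder_def quantizer_def using jump_time_measurable by measurable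

text \<open>Clipping both ends at 1 treats full cells, the shortened last one and the empty ones
  beyond it uniformly.\<close>

lemma cell_quantizer:
  assumes "0 < p"
  shows "cell (quantizer p) i \<inter> {0..<1} = {min 1 (i * p)..<min 1 ((real i + 1) * p)}"
proof -
  have "nat \<lfloor>u / p\<rfloor> = i \<longleftrightarrow> i * p \<le> u \<and> u < (real i + 1) * p" if "0 \<le> u" for u
  proof -
    have "0 \<le> \<lfloor>u / p\<rfloor>" using that assms by simp
    then have "nat \<lfloor>u / p\<rfloor> = i \<longleftrightarrow> \<lfloor>u / p\<rfloor> = int i" by auto
    also have "\<dots> \<longleftrightarrow> i * p \<le> u \<and> u < (real i + 1) * p"
      using assms by (auto simp: floor_eq_iff field_simps)
    finally show ?thesis .
  qed
  then have "u \<in> cell (quantizer p) i \<longleftrightarrow> i * p \<le> u \<and> u < (real i + 1) * p"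
    if "0 \<le> u" "u < 1" for u
    using that by (simp add: cell_def quantizer_def jump_time_sawbridge)
  moreover have "0 \<le> real i * p" using assms by simp
  ultimately show ?thesis
    by (intro set_eqI) (simp add: min_le_iff_disj, smt (verit))
qed

context
  fixes p q :: real and k :: nat
  assumes k: "0 < k" and q: "q = 1 - k * p" "0 \<le> q" "q < p"
begin

lemma quantizer_values:
  "cell_prob (quantizer p) i = (if i < k then p else if i = k then q else 0)"
  "cell_distortion (quantizer p) i = (cell_prob (quantizer p) i)\<^sup>2 / 6"
proof -
  have p: "0 < p" using q by simp
  \<comment> \<open>Cells below \<open>k\<close> end by \<open>k * p \<le> 1\<close> and are full;
    cell \<open>k\<close> is cut at 1 because \<open>q < p\<close> means
    \<open>(k + 1) * p > 1\<close>; later cells have both ends at 1.\<close>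
  have m: "min 1 ((real i + 1) * p) - min 1 (i * p) = (if i < k then p else if i = k then q else 0)"
  proof -
    consider "i < k" | "i = k" | "k + 1 \<le> i" by linarith
    then show ?thesis
    proof cases
      case 1
      then have "(real i + 1) * p \<le> k * p" using p by (intro mult_right_mono) auto
      then show ?thesis using 1 q p by (simp add: algebra_simps)
    next
      case 2
      then show ?thesis using q p by (simp add: algebra_simps)
    next
      case 3
      then have "(k + 1) * p \<le> i * p" using p by (intro mult_right_mono) auto
      then show ?thesis using 3 q p by (simp add: algebra_simps)
    qed
  qed
  have "0 \<le> min 1 (i * p)" "min 1 (i * p) \<le> min 1 ((real i + 1) * p)" "min 1 ((real i + 1) * p) \<le> 1"
    using p by (auto simp: min_def algebra_simps)
  from cell_interval[OF encoder_quantizer this cell_quantizer[OF p]]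
  show "cell_prob (quantizer p) i = (if i < k then p else if i = k then q else 0)"
    "cell_distortion (quantizer p) i = (cell_prob (quantizer p) i)\<^sup>2 / 6"
    unfolding m by auto
qed

lemma distortion_quantizer: "6 * distortion (quantizer p) = k * p\<^sup>2 + q\<^sup>2"
proof -
  have p: "0 < p" using q by simp
  have "distortion (quantizer p) = (\<Sum>i\<in>{..k}. cell_distortion (quantizer p) i)"
  proof (rule distortion_eq_sum[OF encoder_quantizer])
    fix u :: real assume u: "0 \<le> u" "u < 1"
    have "u < (k + 1) * p" using u q by (simp add: algebra_simps)
    then have "u / p < k + 1" using p by (simp add: field_simps)
    then have "\<lfloor>u / p\<rfloor> \<le> int k" by linarith
    then show "quantizer p (sawbridge u) \<in> {..k}"
      using u by (simp add: quantizer_def jump_time_sawbridge)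
  qed simp
  also have "{..k} = insert k {..<k}" by auto
  finally show ?thesis by (simp add: quantizer_values)
qed

lemma entropy_quantizer: "entropy (quantizer p) = ennreal (k * eta p + eta q)"
proof -
  have "entropy (quantizer p) = (\<Sum>i\<in>{..k}. ennreal (eta (cell_prob (quantizer p) i)))"
    unfolding entropy_eq by (rule suminf_finite) (auto simp: quantizer_values eta_def)
  also have "\<dots> = ennreal (\<Sum>i\<in>{..k}. eta (cell_prob (quantizer p) i))"
    by (rule sum_ennreal) (intro eta_nonneg cell_prob_bounds)
  also have "{..k} = insert k {..<k}" by auto
  finally show ?thesis by (simp add: quantizer_values add.commute)
qed

lemma entropy_distortion_eq:
  assumes "k * p\<^sup>2 + q\<^sup>2 = 6 * \<Delta>"
  shows "entropy_distortion \<Delta> = ennreal (k * eta p + eta q)"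
  unfolding entropy_distortion_def
proof (rule antisym)
  show "(INF f \<in> {f. encoder f \<and> distortion f \<le> \<Delta>}. entropy f) \<le> ennreal (k * eta p + eta q)"
    unfolding entropy_quantizer[symmetric]
    using encoder_quantizer distortion_quantizer assms by (intro INF_lower) simp
  show "ennreal (k * eta p + eta q) \<le> (INF f \<in> {f. encoder f \<and> distortion f \<le> \<Delta>}. entropy f)"
    using assms by (intro INF_greatest entropy_ge k q) auto
qed

end

lemma entropy_distortion_ge_sixth:
  assumes "1 / 6 \<le> \<Delta>"
  shows "entropy_distortion \<Delta> = 0"
proof -
  \<comment> \<open>Step length 1 puts all jump times below 1 into one cell: \<open>k = 1\<close>,
    \<open>p = 1\<close>, \<open>q = 0\<close>.\<close>
  have "distortion (quantizer 1) = 1 / 6" "entropy (quantizer 1) = 0"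
    using distortion_quantizer[of 1 0 1] entropy_quantizer[of 1 0 1] by (simp_all add: eta_def)
  then have "entropy_distortion \<Delta> \<le> 0"
    unfolding entropy_distortion_def using assms encoder_quantizer[of 1]
    by (intro INF_lower2[of "quantizer 1"]) auto
  then show ?thesis by simp
qed

theorem theorem2:
  shows "(\<forall>\<Delta>::real. \<Delta> \<ge> 1/6 \<longrightarrow> entropy_distortion \<Delta> = 0)
    \<and> (\<forall>\<Delta>::real. 0 < \<Delta> \<and> \<Delta> < 1/6 \<longrightarrow>
         (\<exists>!p::real. 0 < p \<and> p < 1 \<and>
            of_int \<lfloor>1/p\<rfloor> * p\<^sup>2 + (1 - of_int \<lfloor>1/p\<rfloor> * p)\<^sup>2 = 6 * \<Delta>)
       \<and> (\<forall>p::real. 0 < p \<and> p < 1 \<and>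
            of_int \<lfloor>1/p\<rfloor> * p\<^sup>2 + (1 - of_int \<lfloor>1/p\<rfloor> * p)\<^sup>2 = 6 * \<Delta> \<longrightarrow>
            (let q = 1 - of_int \<lfloor>1/p\<rfloor> * p in
             entropy_distortion \<Delta> =
               ennreal (- of_int \<lfloor>1/p\<rfloor> * p * log 2 p
                        - (if q = 0 then 0 else q * log 2 q)))))"
proof (intro conjI allI impI)
  fix \<Delta> :: real assume "\<Delta> \<ge> 1/6"
  then show "entropy_distortion \<Delta> = 0" by (rule entropy_distortion_ge_sixth)
next
  fix \<Delta> :: real assume \<Delta>: "0 < \<Delta> \<and> \<Delta> < 1/6"
  then obtain p where p: "0 < p" "p < 1" "coincidence p = 6 * \<Delta>"
    using coincidence_surj[of "6 * \<Delta>"] by auto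
  show "\<exists>!p::real. 0 < p \<and> p < 1 \<and>
      of_int \<lfloor>1/p\<rfloor> * p\<^sup>2 + (1 - of_int \<lfloor>1/p\<rfloor> * p)\<^sup>2 = 6 * \<Delta>"
    unfolding coincidence_def[symmetric]
    using p coincidence_inj by (intro ex1I[of _ p]) (auto intro: less_imp_le)
next
  fix \<Delta> p :: real
  assume p: "0 < p \<and> p < 1 \<and>
    of_int \<lfloor>1/p\<rfloor> * p\<^sup>2 + (1 - of_int \<lfloor>1/p\<rfloor> * p)\<^sup>2 = 6 * \<Delta>"
  obtain k :: nat where k: "0 < k" "\<lfloor>1/p\<rfloor> = int k" "1 < (k + 1) * p" "k * p \<le> 1"
    using floor_recip_nat[of p] p by auto
  \<comment> \<open>The two bounds on \<open>k * p\<close> that characterize the floor are the side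
    conditions \<open>q < p\<close> and \<open>0 \<le> q\<close>.\<close>
  have "entropy_distortion \<Delta> = ennreal (k * eta p + eta (1 - k * p))"
    using k p by (intro entropy_distortion_eq) (auto simp: algebra_simps)
  then show "let q = 1 - of_int \<lfloor>1/p\<rfloor> * p in
      entropy_distortion \<Delta> = ennreal (- of_int \<lfloor>1/p\<rfloor> * p * log 2 p
        - (if q = 0 then 0 else q * log 2 q))"
    using p unfolding k(2) Let_def eta_def by (auto simp: algebra_simps)
qed

end
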